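(* Let $Q=H^1(\widehat\Omega;\mathbb{R}^d)$ with inner product $(\cdot,\cdot)_Q$. For $k=0,1,2,\dots$ let the step $s^k\in Q$ and $y^k\in Q$ be given, and assume that $B_0\in\mathcal{L}(Q,Q)$ is a symmetric, positive definite operator. Let $\xi\in(0,1)$, and let $\theta_k$, $\widetilde d^k$ and $B_{k+1}$ be defined from $B_k$, $s^k$, $y^k$ by the damping step and the inverse BFGS update described in the context. Then the damping step ensures that $$(y^k,\widetilde d^k)_Q>0.$$ By induction $B_k$, and thus $B_{k+1}$, remains positive definite.
   Context: Here $d\in\{2,3\}$, $\widehat\Omega\subset\mathbb{R}^d$ is a simply connected reference domain, and $\mathcal{L}(Q,Q)$ denotes the bounded linear operators on $Q$. An operator $B\in\mathcal{L}(Q,Q)$ is symmetric if $(Bp,r)_Q=(p,Br)_Q$ for all $p,r\in Q$, and positive definite if $(p,Bp)_Q>0$ for all $p\in Q\setminus\{0\}$. The setting is a damped inverse BFGS method for minimizing a reduced cost functional $j$ over admissible controls $q\in Q$, where $\nabla_Q j(q)\in Q$ is the gradient of $j$, that is, the Riesz representative of $j'(q)$ with respect to $(\cdot,\cdot)_Q$. The iterates are $q^{k+1}=q^k+t_kd^k$ with search direction $d^k=-B_k\nabla_Q j(q^k)$ and step size $t_k>0$ from a backtracking line search. In the method, $s^k=t_kd^k=q^{k+1}-q^k$ and $y^k=\nabla_Q j(q^{k+1})-\nabla_Q j(q^k)$. Given $B_k$, $s^k$ and $y^k$, the method proceeds as follows. Damping step. Set $$\theta_k=\begin{cases}1, & \text{if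 } (y^k,s^k)_Q\ge \xi\,(y^k,B_ky^k)_Q,\\[4pt] (1-\xi)\,\dfrac{(y^k,B_ky^k)_Q}{(y^k,B_ky^k)_Q-(s^k,y^k)_Q}, & \text{otherwise,}\end{cases}$$ and define the damped step $$\widetilde d^k=\theta_k s^k+(1-\theta_k)B_ky^k .$$ Inverse BFGS update. Define $B_{k+1}\in\mathcal{L}(Q,Q)$ by, for any $p\in Q$, $$B_{k+1}p=B_kp+\frac{(\widetilde d^k-B_ky^k)\,(\widetilde d^k,p)_Q+\widetilde d^k\,(\widetilde d^k-B_ky^k,p)_Q}{(\widetilde d^k,y^k)_Q}-\widetilde d^k\,\frac{(\widetilde d^k-B_ky^k,y^k)_Q}{(\widetilde d^k,y^k)_Q^2}\,(\widetilde d^k,p)_Q .$$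
   Formalization: The claim (y^k, d̃^k)_Q > 0 is proved for y^k ≠ 0, since for y^k = 0 the product is 0 and the update divides by zero; in that case B_{k+1} is taken equal to B_k (convention x/0 = 0). *)

theory Defs
  imports "HOL-Analysis.Analysis"
begin

section \<open>Vector fields modulo null sets\<close>

quotient_type 'n vfield = "real^'n::finite \<Rightarrow> real^'n" / "\<lambda>f g. AE x in lebesgue. f x = g x"
proof (rule equivpI)
  show "reflp (\<lambda>(f::real^'n \<Rightarrow> real^'n) g. AE x in lebesgue. f x = g x)"
    by (simp add: reflp_def)
  show "symp (\<lambda>(f::real^'n \<Rightarrow> real^'n) g. AE x in lebesgue. f x = g x)"
    by (simp add: symp_def eq_commute)
  show "transp (\<lambda>(f::real^'n \<Rightarrow> real^'n) g. AE x in lebesgue. f x = g x)"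
  proof (rule transpI)
    fix f g h :: "real^'n \<Rightarrow> real^'n"
    assume "AE x in lebesgue. f x = g x" and "AE x in lebesgue. g x = h x"
    then show "AE x in lebesgue. f x = h x"
      by eventually_elim simp
  qed
qed

instantiation vfield :: (finite) real_vector
begin

lift_definition zero_vfield :: "'a vfield" is "\<lambda>_. 0" .

lift_definition plus_vfield :: "'a vfield \<Rightarrow> 'a vfield \<Rightarrow> 'a vfield" is "\<lambda>f g x. f x + g x"
  by (auto elim: eventually_elim2)

lift_definition minus_vfield :: "'a vfield \<Rightarrow> 'a vfield \<Rightarrow> 'a vfield" is "\<lambda>f g x. f x - g x"
  by (auto elim: eventually_elim2)

lift_definition uminus_vfield :: "'a vfield \<Rightarrow> 'a vfield" is "\<lambda>f x. - f x"
  by (auto elim: eventually_mono)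

lift_definition scaleR_vfield :: "real \<Rightarrow> 'a vfield \<Rightarrow> 'a vfield" is "\<lambda>a f x. a *\<^sub>R f x"
  by (auto elim: eventually_mono)

instance
  by standard (transfer; simp add: algebra_simps)+

end


section \<open>The Sobolev space \<open>H\<^sup>1(\<Omega>; \<real>\<^sup>d)\<close>\<close>

definition partial_deriv :: "'n::finite \<Rightarrow> (real^'n \<Rightarrow> real) \<Rightarrow> real^'n \<Rightarrow> real" where
  "partial_deriv j \<phi> x = frechet_derivative \<phi> (at x) (axis j 1)"

text \<open>If all iterated partial derivatives are differentiable everywhere, then they are all
  continuous, so the first condition says that \<open>\<phi>\<close> is of class \<open>C\<^sup>\<infinity>\<close>.\<close>

definition test_function :: "(real^'n::finite) set \<Rightarrow> (real^'n \<Rightarrow> real) \<Rightarrow> bool" where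
  "test_function \<Omega> \<phi> \<longleftrightarrow>
     (\<forall>js x. foldr partial_deriv js \<phi> differentiable (at x)) \<and>
     compact (closure {x. \<phi> x \<noteq> 0}) \<and> closure {x. \<phi> x \<noteq> 0} \<subseteq> \<Omega>"

definition square_integrable_on ::
    "(real^'n::finite \<Rightarrow> 'b::euclidean_space) \<Rightarrow> (real^'n) set \<Rightarrow> bool" where
  "square_integrable_on f \<Omega> \<longleftrightarrow>
     set_borel_measurable lebesgue \<Omega> f \<and> set_integrable lebesgue \<Omega> (\<lambda>x. (norm (f x))\<^sup>2)"

text \<open>The entry \<open>G x $ i $ j\<close> is the weak derivative of the component \<open>f\<^sub>i\<close> in direction \<open>j\<close>.\<close>

definition weak_gradient ::
    "(real^'n::finite) set \<Rightarrow> (real^'n \<Rightarrow> real^'n) \<Rightarrow> (real^'n \<Rightarrow> real^'n^'n) \<Rightarrow> bool" where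
  "weak_gradient \<Omega> f G \<longleftrightarrow>
     (\<forall>\<phi> i j. test_function \<Omega> \<phi> \<longrightarrow>
        set_lebesgue_integral lebesgue \<Omega> (\<lambda>x. f x $ i * partial_deriv j \<phi> x) =
        - set_lebesgue_integral lebesgue \<Omega> (\<lambda>x. G x $ i $ j * \<phi> x))"

text \<open>A function on \<open>\<Omega>\<close> is represented by its extension by zero to the whole space, so that
  equality in \<^typ>\<open>'n vfield\<close> is equality almost everywhere on \<open>\<Omega>\<close>.\<close>

definition H1_rep ::
    "(real^'n::finite) set \<Rightarrow> 'n vfield \<Rightarrow> (real^'n \<Rightarrow> real^'n) \<Rightarrow> (real^'n \<Rightarrow> real^'n^'n) \<Rightarrow> bool"
  where
  "H1_rep \<Omega> p f G \<longleftrightarrow>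
     p = abs_vfield f \<and> (\<forall>x. x \<notin> \<Omega> \<longrightarrow> f x = 0) \<and>
     square_integrable_on f \<Omega> \<and> square_integrable_on G \<Omega> \<and> weak_gradient \<Omega> f G"

definition H1 :: "(real^'n::finite) set \<Rightarrow> 'n vfield set" where
  "H1 \<Omega> = {p. \<exists>f G. H1_rep \<Omega> p f G}"

text \<open>The inner product is left arbitrary, subject to its norm being equivalent to the standard
  Sobolev norm. The standard inner product \<open>\<integral>\<^sub>\<Omega> p \<bullet> r + \<nabla>p : \<nabla>r\<close> satisfies this with \<open>c = C = 1\<close>.
  The library norm on matrices is the Frobenius norm.\<close>

definition H1_inner_product ::
    "(real^'n::finite) set \<Rightarrow> ('n vfield \<Rightarrow> 'n vfield \<Rightarrow> real) \<Rightarrow> bool" where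
  "H1_inner_product \<Omega> ip \<longleftrightarrow>
     (\<forall>p\<in>H1 \<Omega>. \<forall>r\<in>H1 \<Omega>. ip p r = ip r p) \<and>
     (\<forall>p\<in>H1 \<Omega>. \<forall>q\<in>H1 \<Omega>. \<forall>r\<in>H1 \<Omega>. ip (p + q) r = ip p r + ip q r) \<and>
     (\<forall>a. \<forall>p\<in>H1 \<Omega>. \<forall>r\<in>H1 \<Omega>. ip (a *\<^sub>R p) r = a * ip p r) \<and>
     (\<forall>p\<in>H1 \<Omega>. p \<noteq> 0 \<longrightarrow> 0 < ip p p) \<and>
     (\<exists>c>0. \<exists>C. \<forall>p f G. H1_rep \<Omega> p f G \<longrightarrow>
        (let N = set_lebesgue_integral lebesgue \<Omega> (\<lambda>x. (norm (f x))\<^sup>2) +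
                 set_lebesgue_integral lebesgue \<Omega> (\<lambda>x. (norm (G x))\<^sup>2)
         in c * N \<le> ip p p \<and> ip p p \<le> C * N))"


section \<open>Operators on a space \<open>Q\<close> with inner product \<open>ip\<close>\<close>

definition bounded_operators ::
    "'q::real_vector set \<Rightarrow> ('q \<Rightarrow> 'q \<Rightarrow> real) \<Rightarrow> ('q \<Rightarrow> 'q) set" where
  "bounded_operators Q ip = {B.
     (\<forall>p\<in>Q. B p \<in> Q) \<and>
     (\<forall>p\<in>Q. \<forall>r\<in>Q. B (p + r) = B p + B r) \<and>
     (\<forall>a. \<forall>p\<in>Q. B (a *\<^sub>R p) = a *\<^sub>R B p) \<and>
     (\<exists>C. \<forall>p\<in>Q. sqrt (ip (B p) (B p)) \<le> C * sqrt (ip p p))}"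

definition symmetric_operator ::
    "'q set \<Rightarrow> ('q \<Rightarrow> 'q \<Rightarrow> real) \<Rightarrow> ('q \<Rightarrow> 'q) \<Rightarrow> bool" where
  "symmetric_operator Q ip B \<longleftrightarrow> (\<forall>p\<in>Q. \<forall>r\<in>Q. ip (B p) r = ip p (B r))"

definition positive_definite ::
    "'q::zero set \<Rightarrow> ('q \<Rightarrow> 'q \<Rightarrow> real) \<Rightarrow> ('q \<Rightarrow> 'q) \<Rightarrow> bool" where
  "positive_definite Q ip B \<longleftrightarrow> (\<forall>p\<in>Q - {0}. 0 < ip p (B p))"


section \<open>Damped inverse BFGS update\<close>

definition damping_parameter ::
    "('q \<Rightarrow> 'q \<Rightarrow> real) \<Rightarrow> real \<Rightarrow> ('q \<Rightarrow> 'q) \<Rightarrow> 'q \<Rightarrow> 'q \<Rightarrow> real" where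
  "damping_parameter ip \<xi> B s y =
     (if ip y s \<ge> \<xi> * ip y (B y) then 1
      else (1 - \<xi>) * (ip y (B y) / (ip y (B y) - ip s y)))"

definition damped_step ::
    "('q::real_vector \<Rightarrow> 'q \<Rightarrow> real) \<Rightarrow> real \<Rightarrow> ('q \<Rightarrow> 'q) \<Rightarrow> 'q \<Rightarrow> 'q \<Rightarrow> 'q" where
  "damped_step ip \<xi> B s y =
     (let \<theta> = damping_parameter ip \<xi> B s y in \<theta> *\<^sub>R s + (1 - \<theta>) *\<^sub>R B y)"

text \<open>Here \<open>d\<close> is the damped step. For \<open>y = 0\<close> the denominators vanish; the convention
  \<open>x / 0 = 0\<close> then leaves the operator unchanged.\<close>

definition inverse_bfgs_update ::
    "('q::real_vector \<Rightarrow> 'q \<Rightarrow> real) \<Rightarrow> ('q \<Rightarrow> 'q) \<Rightarrow> 'q \<Rightarrow> 'q \<Rightarrow> 'q \<Rightarrow> 'q" where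
  "inverse_bfgs_update ip B d y p =
     B p
     + (1 / ip d y) *\<^sub>R (ip d p *\<^sub>R (d - B y) + ip (d - B y) p *\<^sub>R d)
     - (ip (d - B y) y / (ip d y)\<^sup>2 * ip d p) *\<^sub>R d"

end

theory Submission
  imports Defs
begin

text \<open>
  Write \<open>a = (y, B y)\<close>. If damping is active, \<open>\<theta>\<close> is chosen so that
  \<open>(y, d) = a - \<theta> (a - (s, y)) = \<xi> a\<close>; otherwise \<open>d = s\<close> and \<open>(y, s) \<ge> \<xi> a\<close>. Hence \<open>(y, d) \<ge> \<xi> a > 0\<close>
  for \<open>y \<noteq> 0\<close>. With \<open>\<alpha> = (d, p) / (d, y)\<close>, completing the square in the updated operator \<open>B'\<close> gives
  \[(p, B' p) = (p - \alpha y, B (p - \alpha y)) + \frac{(d, p)^2}{(d, y)},\]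
  and the two summands cannot both vanish for \<open>p \<noteq> 0\<close>.
\<close>

section \<open>Square integrable functions\<close>

text \<open>The bound |u + v|^2 \<le> 2|u|^2 + 2|v|^2 dominates the new integrand by an integrable
  one; what remains is measurability.\<close>

lemma square_integrable_on_add:
  fixes f g :: "real^'n \<Rightarrow> 'b::euclidean_space"
  assumes "square_integrable_on f \<Omega>" "square_integrable_on g \<Omega>"
  shows "square_integrable_on (\<lambda>x. f x + g x) \<Omega>"
proof -
  have f: "(\<lambda>x. indicator \<Omega> x *\<^sub>R f x) \<in> borel_measurable lebesgue"
      "integrable lebesgue (\<lambda>x. indicator \<Omega> x *\<^sub>R (norm (f x))\<^sup>2)"
    and g: "(\<lambda>x. indicator \<Omega> x *\<^sub>R g x) \<in> borel_measurable lebesgue"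
      "integrable lebesgue (\<lambda>x. indicator \<Omega> x *\<^sub>R (norm (g x))\<^sup>2)"
    using assms by (auto simp: square_integrable_on_def set_borel_measurable_def set_integrable_def)
  have fg: "(\<lambda>x. indicator \<Omega> x *\<^sub>R (f x + g x)) \<in> borel_measurable lebesgue"
    using borel_measurable_add[OF f(1) g(1)] by (simp add: scaleR_add_right)
  have "(\<lambda>x. (norm (indicator \<Omega> x *\<^sub>R (f x + g x)))\<^sup>2) \<in> borel_measurable lebesgue"
    using fg by measurable
  \<comment> \<open>Measurability is known only after multiplication by the indicator, which equals
    its own square and so can be moved out of the squared norm.\<close>
  also have "(\<lambda>x. (norm (indicator \<Omega> x *\<^sub>R (f x + g x)))\<^sup>2) =
      (\<lambda>x. indicator \<Omega> x *\<^sub>R (norm (f x + g x))\<^sup>2)"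
    by (auto simp: indicator_def)
  finally have m: "(\<lambda>x. indicator \<Omega> x *\<^sub>R (norm (f x + g x))\<^sup>2) \<in> borel_measurable lebesgue" .
  have b: "(norm (u + v))\<^sup>2 \<le> 2 * (norm u)\<^sup>2 + 2 * (norm v)\<^sup>2" for u v :: 'b
  proof -
    have "(norm (u + v))\<^sup>2 \<le> (norm u + norm v)\<^sup>2"
      by (simp add: norm_triangle_ineq power_mono)
    also have "\<dots> \<le> 2 * (norm u)\<^sup>2 + 2 * (norm v)\<^sup>2"
      using sum_squares_bound[of "norm u" "norm v"] by (simp add: power2_sum)
    finally show ?thesis .
  qed
  have "integrable lebesgue (\<lambda>x. indicator \<Omega> x *\<^sub>R (norm (f x + g x))\<^sup>2)"
  proof (rule Bochner_Integration.integrable_bound[OF _ m])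
    show "integrable lebesgue
        (\<lambda>x. 2 * (indicator \<Omega> x *\<^sub>R (norm (f x))\<^sup>2) + 2 * (indicator \<Omega> x *\<^sub>R (norm (g x))\<^sup>2))"
      using f(2) g(2) by (intro Bochner_Integration.integrable_add integrable_mult_right)
  qed (use b in \<open>auto simp: indicator_def\<close>)
  with fg show ?thesis
    by (simp add: square_integrable_on_def set_borel_measurable_def set_integrable_def)
qed

lemma square_integrable_on_scaleR:
  fixes f :: "real^'n \<Rightarrow> 'b::euclidean_space"
  assumes "square_integrable_on f \<Omega>"
  shows "square_integrable_on (\<lambda>x. a *\<^sub>R f x) \<Omega>"
proof -
  have f: "(\<lambda>x. indicator \<Omega> x *\<^sub>R f x) \<in> borel_measurable lebesgue"
      "integrable lebesgue (\<lambda>x. indicator \<Omega> x *\<^sub>R (norm (f x))\<^sup>2)"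
    using assms by (auto simp: square_integrable_on_def set_borel_measurable_def set_integrable_def)
  have "(\<lambda>x. a *\<^sub>R indicator \<Omega> x *\<^sub>R f x) \<in> borel_measurable lebesgue"
    using f(1) by measurable
  moreover have "integrable lebesgue (\<lambda>x. a\<^sup>2 * (indicator \<Omega> x *\<^sub>R (norm (f x))\<^sup>2))"
    using f(2) by (rule integrable_mult_right)
  ultimately show ?thesis
    by (simp add: square_integrable_on_def set_borel_measurable_def set_integrable_def
        power_mult_distrib mult.left_commute mult.commute)
qed

text \<open>A coordinate projection is continuous and does not increase the norm. Applied twice, it
  reaches the entries \<open>G x $ i $ j\<close> of a matrix field.\<close>

lemma square_integrable_on_nth:
  fixes f :: "real^'n \<Rightarrow> ('b::euclidean_space)^'m"
  assumes "square_integrable_on f \<Omega>"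
  shows "square_integrable_on (\<lambda>x. f x $ i) \<Omega>"
proof -
  have f: "(\<lambda>x. indicator \<Omega> x *\<^sub>R f x) \<in> borel_measurable lebesgue"
      "integrable lebesgue (\<lambda>x. indicator \<Omega> x *\<^sub>R (norm (f x))\<^sup>2)"
    using assms by (auto simp: square_integrable_on_def set_borel_measurable_def set_integrable_def)
  have "(\<lambda>v::'b^'m. v $ i) \<in> borel_measurable borel"
    by (intro borel_measurable_continuous_onI continuous_intros)
  from measurable_compose[OF f(1) this]
  have m: "(\<lambda>x. indicator \<Omega> x *\<^sub>R f x $ i) \<in> borel_measurable lebesgue"
    by simp
  have "(\<lambda>x. (norm (indicator \<Omega> x *\<^sub>R f x $ i))\<^sup>2) \<in> borel_measurable lebesgue"
    using m by measurable
  also have "(\<lambda>x. (norm (indicator \<Omega> x *\<^sub>R f x $ i))\<^sup>2) = (\<lambda>x. indicator \<Omega> x *\<^sub>R (norm (f x $ i))\<^sup>2)"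
    by (auto simp: indicator_def)
  finally have m2: "(\<lambda>x. indicator \<Omega> x *\<^sub>R (norm (f x $ i))\<^sup>2) \<in> borel_measurable lebesgue" .
  have "integrable lebesgue (\<lambda>x. indicator \<Omega> x *\<^sub>R (norm (f x $ i))\<^sup>2)"
    by (rule Bochner_Integration.integrable_bound[OF f(2) m2])
       (auto simp: indicator_def intro!: power_mono Finite_Cartesian_Product.norm_nth_le AE_I2)
  with m show ?thesis
    by (simp add: square_integrable_on_def set_borel_measurable_def set_integrable_def)
qed

text \<open>Since 2|uv| \<le> u^2 + v^2, the product is dominated by an integrable sum. This makes
  both integrals in \<open>weak_gradient\<close> converge.\<close>

lemma square_integrable_on_mult:
  fixes f g :: "real^'n \<Rightarrow> real"
  assumes "square_integrable_on f \<Omega>" "square_integrable_on g \<Omega>"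
  shows "set_integrable lebesgue \<Omega> (\<lambda>x. f x * g x)"
proof -
  have f: "(\<lambda>x. indicator \<Omega> x *\<^sub>R f x) \<in> borel_measurable lebesgue"
      "integrable lebesgue (\<lambda>x. indicator \<Omega> x *\<^sub>R (norm (f x))\<^sup>2)"
    and g: "(\<lambda>x. indicator \<Omega> x *\<^sub>R g x) \<in> borel_measurable lebesgue"
      "integrable lebesgue (\<lambda>x. indicator \<Omega> x *\<^sub>R (norm (g x))\<^sup>2)"
    using assms by (auto simp: square_integrable_on_def set_borel_measurable_def set_integrable_def)
  have "(\<lambda>x. (indicator \<Omega> x *\<^sub>R f x) * (indicator \<Omega> x *\<^sub>R g x)) \<in> borel_measurable lebesgue"
    using f(1) g(1) by measurable
  also have "(\<lambda>x. (indicator \<Omega> x *\<^sub>R f x) * (indicator \<Omega> x *\<^sub>R g x)) =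
      (\<lambda>x. indicator \<Omega> x *\<^sub>R (f x * g x))"
    by (auto simp: indicator_def)
  finally have m: "(\<lambda>x. indicator \<Omega> x *\<^sub>R (f x * g x)) \<in> borel_measurable lebesgue" .
  have b: "\<bar>u * v\<bar> \<le> u\<^sup>2 + v\<^sup>2" for u v :: real
  proof -
    have "2 * (\<bar>u\<bar> * \<bar>v\<bar>) \<le> u\<^sup>2 + v\<^sup>2"
      using sum_squares_bound[of "\<bar>u\<bar>" "\<bar>v\<bar>"] by simp
    moreover have "0 \<le> \<bar>u\<bar> * \<bar>v\<bar>" by simp
    ultimately show ?thesis unfolding abs_mult by linarith
  qed
  show ?thesis
    unfolding set_integrable_def
  proof (rule Bochner_Integration.integrable_bound[OF _ m])
    show "integrable lebesgue
        (\<lambda>x. indicator \<Omega> x *\<^sub>R (norm (f x))\<^sup>2 + indicator \<Omega> x *\<^sub>R (norm (g x))\<^sup>2)"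
      using f(2) g(2) by (rule Bochner_Integration.integrable_add)
  qed (use b in \<open>auto simp: indicator_def\<close>)
qed

lemma continuous_compact_support_square_integrable_on:
  fixes h :: "real^'n \<Rightarrow> real"
  assumes h: "continuous_on UNIV h" and K: "compact K" "\<And>x. x \<notin> K \<Longrightarrow> h x = 0"
    and \<Omega>: "\<Omega> \<in> sets lebesgue"
  shows "square_integrable_on h \<Omega>"
proof -
  have hm: "h \<in> borel_measurable borel"
    using h by (rule borel_measurable_continuous_onI)
  have "integrable lborel (\<lambda>x. indicator K x *\<^sub>R (norm (h x))\<^sup>2)"
    by (rule borel_integrable_compact[OF K(1)])
       (intro continuous_intros continuous_on_subset[OF h] subset_UNIV)
  also have "(\<lambda>x. indicator K x *\<^sub>R (norm (h x))\<^sup>2) = (\<lambda>x. (norm (h x))\<^sup>2)"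
    using K(2) by (fastforce simp: indicator_def)
  finally have "integrable lebesgue (\<lambda>x. (norm (h x))\<^sup>2)"
    using integrable_completion[of "\<lambda>x. (norm (h x))\<^sup>2" lborel] hm by simp
  then have "set_integrable lebesgue \<Omega> (\<lambda>x. (norm (h x))\<^sup>2)"
    unfolding set_integrable_def by (rule integrable_mult_indicator[OF \<Omega>])
  moreover have "set_borel_measurable lebesgue \<Omega> h"
    unfolding set_borel_measurable_def
    using borel_measurable_scaleR[OF borel_measurable_indicator[OF \<Omega>] measurable_completion[of h lborel borel]] hm
    by simp
  ultimately show ?thesis
    by (simp add: square_integrable_on_def)
qed


section \<open>\<open>H\<^sup>1\<close> is a linear subspace\<close>

lemma test_function_square_integrable_on:
  assumes "test_function \<Omega> \<phi>" "\<Omega> \<in> sets lebesgue"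
  shows "square_integrable_on \<phi> \<Omega>" "square_integrable_on (partial_deriv j \<phi>) \<Omega>"
proof -
  let ?K = "closure {x. \<phi> x \<noteq> 0}"
  have K: "compact ?K" and diff: "foldr partial_deriv js \<phi> differentiable (at x)" for js x
    using assms(1) by (auto simp: test_function_def)
  have 0: "\<phi> x = 0" if "x \<in> - ?K" for x
    using that subsetD[OF closure_subset, of x "{x. \<phi> x \<noteq> 0}"] by blast
  \<comment> \<open>The complement of the support is open and \<phi> is zero on it, so the
    derivative vanishes there: \<phi> and its partial derivatives share the compact set
    \<open>?K\<close>.\<close>
  have "partial_deriv j \<phi> x = 0" if x: "x \<in> - ?K" for x
  proof -
    have "((\<lambda>_. 0) has_derivative (\<lambda>_. 0)) (at x)"
      by (rule has_derivative_const)
    then have "(\<phi> has_derivative (\<lambda>_. 0)) (at x)"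
      by (rule has_derivative_transform_within_open[OF _ open_Compl[OF closed_closure] x 0[symmetric]])
    then have "frechet_derivative \<phi> (at x) = (\<lambda>_. 0)"
      by (rule frechet_derivative_at[symmetric])
    then show ?thesis
      by (simp add: partial_deriv_def)
  qed
  \<comment> \<open>The lists \<open>[]\<close> and \<open>[j]\<close> select differentiability of
    \<phi> itself and of its partial derivative; each implies continuity.\<close>
  moreover have "continuous_on UNIV \<phi>" "continuous_on UNIV (partial_deriv j \<phi>)"
    using diff[of "[]"] diff[of "[j]"]
    by (simp_all add: continuous_at_imp_continuous_on differentiable_imp_continuous_within)
  ultimately show "square_integrable_on \<phi> \<Omega>" "square_integrable_on (partial_deriv j \<phi>) \<Omega>"
    using continuous_compact_support_square_integrable_on[OF _ K _ assms(2)] 0 by blast+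
qed

text \<open>Both sides of the defining identity are additive once every summand is integrable, and
  each summand is a product of two square integrable functions.\<close>

lemma weak_gradient_add:
  fixes \<Omega> :: "(real^'n) set"
  assumes \<Omega>: "\<Omega> \<in> sets lebesgue"
    and f: "square_integrable_on f \<Omega>" "square_integrable_on F \<Omega>" "weak_gradient \<Omega> f F"
    and g: "square_integrable_on g \<Omega>" "square_integrable_on G \<Omega>" "weak_gradient \<Omega> g G"
  shows "weak_gradient \<Omega> (\<lambda>x. f x + g x) (\<lambda>x. F x + G x)"
  unfolding weak_gradient_def
proof (intro allI impI)
  fix \<phi> :: "real^'n \<Rightarrow> real" and i j
  assume \<phi>: "test_function \<Omega> \<phi>"
  note sq = test_function_square_integrable_on[OF \<phi> \<Omega>]
  have int: "set_integrable lebesgue \<Omega> (\<lambda>x. h x $ i * partial_deriv j \<phi> x)"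
    if "square_integrable_on h \<Omega>" for h :: "real^'n \<Rightarrow> real^'n"
    by (intro square_integrable_on_mult square_integrable_on_nth that sq)
  have int': "set_integrable lebesgue \<Omega> (\<lambda>x. H x $ i $ j * \<phi> x)"
    if "square_integrable_on H \<Omega>" for H :: "real^'n \<Rightarrow> real^'n^'n"
    by (intro square_integrable_on_mult square_integrable_on_nth that sq)
  show "(LINT x:\<Omega>|lebesgue. (f x + g x) $ i * partial_deriv j \<phi> x) =
      - (LINT x:\<Omega>|lebesgue. (F x + G x) $ i $ j * \<phi> x)"
    using f(3) g(3) \<phi> set_integral_add(2)[OF int[OF f(1)] int[OF g(1)]]
      set_integral_add(2)[OF int'[OF f(2)] int'[OF g(2)]]
    by (simp add: distrib_right weak_gradient_def)
qed

lemma weak_gradient_scaleR: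
  assumes "weak_gradient \<Omega> f F"
  shows "weak_gradient \<Omega> (\<lambda>x. a *\<^sub>R f x) (\<lambda>x. a *\<^sub>R F x)"
  using assms by (simp add: weak_gradient_def mult.assoc)

text \<open>Vector operations on classes are pointwise on representatives, so pairs (function, weak
  gradient) can be added and scaled directly; extension by zero is preserved.\<close>

lemma subspace_H1:
  assumes \<Omega>: "\<Omega> \<in> sets lebesgue"
  shows "subspace (H1 \<Omega>)"
proof (rule subspaceI)
  have "H1_rep \<Omega> 0 (\<lambda>_. 0) (\<lambda>_. 0)"
    by (simp add: H1_rep_def zero_vfield_def square_integrable_on_def weak_gradient_def
        set_borel_measurable_def set_integrable_def)
  then show "0 \<in> H1 \<Omega>"
    by (auto simp: H1_def)
next
  fix p q
  assume "p \<in> H1 \<Omega>" "q \<in> H1 \<Omega>"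
  then obtain f F g G where fg: "H1_rep \<Omega> p f F" "H1_rep \<Omega> q g G"
    by (auto simp: H1_def)
  then have "H1_rep \<Omega> (p + q) (\<lambda>x. f x + g x) (\<lambda>x. F x + G x)"
    using \<Omega> by (simp add: H1_rep_def plus_vfield.abs_eq square_integrable_on_add weak_gradient_add)
  then show "p + q \<in> H1 \<Omega>"
    by (auto simp: H1_def)
next
  fix a p
  assume "p \<in> H1 \<Omega>"
  then obtain f F where "H1_rep \<Omega> p f F"
    by (auto simp: H1_def)
  then have "H1_rep \<Omega> (a *\<^sub>R p) (\<lambda>x. a *\<^sub>R f x) (\<lambda>x. a *\<^sub>R F x)"
    by (simp add: H1_rep_def scaleR_vfield.abs_eq square_integrable_on_scaleR weak_gradient_scaleR)
  then show "a *\<^sub>R p \<in> H1 \<Omega>"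
    by (auto simp: H1_def)
qed


section \<open>The damped update on an inner product space\<close>

text \<open>The form \<open>ip\<close> is constrained only on a carrier set inside a larger type,
  hence a locale relative to \<open>Q\<close> instead of a type class.\<close>

locale inner_product_subspace =
  fixes Q :: "'q::real_vector set" and ip :: "'q \<Rightarrow> 'q \<Rightarrow> real"
  assumes subspace: "subspace Q"
    and sym: "p \<in> Q \<Longrightarrow> r \<in> Q \<Longrightarrow> ip p r = ip r p"
    and add_left: "p \<in> Q \<Longrightarrow> q \<in> Q \<Longrightarrow> r \<in> Q \<Longrightarrow> ip (p + q) r = ip p r + ip q r"
    and scale_left: "p \<in> Q \<Longrightarrow> r \<in> Q \<Longrightarrow> ip (a *\<^sub>R p) r = a * ip p r"
    and pos: "p \<in> Q \<Longrightarrow> p \<noteq> 0 \<Longrightarrow> 0 < ip p p"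
begin

lemma mem [simp, intro]:
  "0 \<in> Q" "p \<in> Q \<Longrightarrow> r \<in> Q \<Longrightarrow> p + r \<in> Q" "p \<in> Q \<Longrightarrow> r \<in> Q \<Longrightarrow> p - r \<in> Q" "p \<in> Q \<Longrightarrow> a *\<^sub>R p \<in> Q"
  using subspace by (auto simp: subspace_0 subspace_add subspace_diff subspace_scale)

lemma add_right: "p \<in> Q \<Longrightarrow> q \<in> Q \<Longrightarrow> r \<in> Q \<Longrightarrow> ip r (p + q) = ip r p + ip r q"
  using add_left sym by simp

lemma scale_right: "p \<in> Q \<Longrightarrow> r \<in> Q \<Longrightarrow> ip r (a *\<^sub>R p) = a * ip r p"
  using scale_left sym by simp

lemma diff_left: "p \<in> Q \<Longrightarrow> q \<in> Q \<Longrightarrow> r \<in> Q \<Longrightarrow> ip (p - q) r = ip p r - ip q r"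
  using add_left[of "p - q" q r] by simp

lemma diff_right: "p \<in> Q \<Longrightarrow> q \<in> Q \<Longrightarrow> r \<in> Q \<Longrightarrow> ip r (p - q) = ip r p - ip r q"
  using diff_left sym by simp

lemma zero_left [simp]: "r \<in> Q \<Longrightarrow> ip 0 r = 0"
  using scale_left[of 0 r 0] by simp

lemma zero_right [simp]: "r \<in> Q \<Longrightarrow> ip r 0 = 0"
  using zero_left sym by simp

lemmas ip_simps = add_left add_right scale_left scale_right diff_left diff_right

lemma nonneg: "p \<in> Q \<Longrightarrow> 0 \<le> ip p p"
  using pos[of p] by (cases "p = 0") auto

section \<open>Induced norm and Cauchy-Schwarz inequality\<close>

definition nrm :: "'q \<Rightarrow> real" where "nrm p = sqrt (ip p p)"

lemma nrm_nonneg: "p \<in> Q \<Longrightarrow> 0 \<le> nrm p"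
  by (simp add: nrm_def nonneg)

lemma nrm_sq: "p \<in> Q \<Longrightarrow> (nrm p)\<^sup>2 = ip p p"
  by (simp add: nrm_def nonneg)

lemma Cauchy_Schwarz:
  assumes "p \<in> Q" "r \<in> Q"
  shows "\<bar>ip p r\<bar> \<le> nrm p * nrm r"
proof (cases "r = 0")
  case False
  \<comment> \<open>\<open>t *\<^sub>R r\<close> is the orthogonal projection of \<open>p\<close>
    onto the line through \<open>r\<close>; nonnegativity of the squared residual is the
    claim.\<close>
  define t where "t = ip p r / ip r r"
  have r: "0 < ip r r" using pos assms False by blast
  have "0 \<le> ip (p - t *\<^sub>R r) (p - t *\<^sub>R r)"
    using assms by (intro nonneg) auto
  also have "\<dots> = ip p p - 2 * t * ip p r + t\<^sup>2 * ip r r"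
    using assms by (simp add: ip_simps sym[of r p] power2_eq_square algebra_simps)
  also have "\<dots> = ip p p - (ip p r)\<^sup>2 / ip r r"
    using r by (simp add: t_def power2_eq_square field_simps)
  finally have "(ip p r)\<^sup>2 \<le> ip p p * ip r r"
    using r by (simp add: field_simps)
  also have "\<dots> = (nrm p * nrm r)\<^sup>2"
    using assms by (simp add: power_mult_distrib nrm_sq)
  finally show ?thesis
    using assms by (simp add: abs_le_square_iff[symmetric] nrm_nonneg)
qed (use assms in \<open>simp add: nrm_def\<close>)

lemma nrm_add:
  assumes "p \<in> Q" "r \<in> Q"
  shows "nrm (p + r) \<le> nrm p + nrm r"
proof (rule power2_le_imp_le)
  have "(nrm (p + r))\<^sup>2 = (nrm p)\<^sup>2 + 2 * ip p r + (nrm r)\<^sup>2"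
    using assms by (simp add: nrm_sq ip_simps sym[of r p])
  also have "\<dots> \<le> (nrm p + nrm r)\<^sup>2"
    using Cauchy_Schwarz[OF assms] by (simp add: power2_sum)
  finally show "(nrm (p + r))\<^sup>2 \<le> (nrm p + nrm r)\<^sup>2" .
qed (use assms in \<open>simp add: nrm_nonneg\<close>)

lemma nrm_scale: "p \<in> Q \<Longrightarrow> nrm (a *\<^sub>R p) = \<bar>a\<bar> * nrm p"
  by (simp add: nrm_def scale_left scale_right real_sqrt_mult flip: mult.assoc)

section \<open>Calculus of bounded operators\<close>

lemma bounded_operatorsD:
  assumes "B \<in> bounded_operators Q ip"
  shows "p \<in> Q \<Longrightarrow> B p \<in> Q" "p \<in> Q \<Longrightarrow> r \<in> Q \<Longrightarrow> B (p + r) = B p + B r"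
    "p \<in> Q \<Longrightarrow> B (a *\<^sub>R p) = a *\<^sub>R B p" "\<exists>C. \<forall>p\<in>Q. nrm (B p) \<le> C * nrm p"
    "p \<in> Q \<Longrightarrow> r \<in> Q \<Longrightarrow> B (p - r) = B p - B r"
proof -
  show add: "p \<in> Q \<Longrightarrow> r \<in> Q \<Longrightarrow> B (p + r) = B p + B r" for p r
    using assms by (simp add: bounded_operators_def)
  show "B (p - r) = B p - B r" if "p \<in> Q" "r \<in> Q"
    using add[of "p - r" r] that by simp
qed (use assms in \<open>auto simp: bounded_operators_def nrm_def\<close>)

lemma bounded_operatorsI:
  assumes "\<And>p. p \<in> Q \<Longrightarrow> B p \<in> Q" "\<And>p r. p \<in> Q \<Longrightarrow> r \<in> Q \<Longrightarrow> B (p + r) = B p + B r"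
    "\<And>a p. p \<in> Q \<Longrightarrow> B (a *\<^sub>R p) = a *\<^sub>R B p" "\<And>p. p \<in> Q \<Longrightarrow> nrm (B p) \<le> C * nrm p"
  shows "B \<in> bounded_operators Q ip"
  unfolding bounded_operators_def
  by (intro CollectI conjI ballI allI exI[of _ C] assms(1-3) assms(4)[unfolded nrm_def])

lemma bounded_operators_add:
  assumes "A \<in> bounded_operators Q ip" "B \<in> bounded_operators Q ip"
  shows "(\<lambda>p. A p + B p) \<in> bounded_operators Q ip"
proof -
  note A = bounded_operatorsD[OF assms(1)] and B = bounded_operatorsD[OF assms(2)]
  obtain C D where "\<forall>p\<in>Q. nrm (A p) \<le> C * nrm p" "\<forall>p\<in>Q. nrm (B p) \<le> D * nrm p"
    using A(4) B(4) by blast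
  then have "nrm (A p + B p) \<le> (C + D) * nrm p" if "p \<in> Q" for p
    using nrm_add[of "A p" "B p"] A(1) B(1) that by (fastforce simp: distrib_right)
  from bounded_operatorsI[OF _ _ _ this] show ?thesis
    using A(1-3) B(1-3) by (simp add: algebra_simps)
qed

text \<open>Cauchy-Schwarz bounds the functional given by \<open>v\<close>. The BFGS correction is a
  sum of operators of this form.\<close>

lemma rank_one_bounded:
  assumes "u \<in> Q" "v \<in> Q"
  shows "(\<lambda>p. (c * ip v p) *\<^sub>R u) \<in> bounded_operators Q ip"
proof -
  have "nrm ((c * ip v p) *\<^sub>R u) \<le> (\<bar>c\<bar> * nrm v * nrm u) * nrm p" if "p \<in> Q" for p
  proof -
    have "nrm ((c * ip v p) *\<^sub>R u) = \<bar>c\<bar> * nrm u * \<bar>ip v p\<bar>"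
      using assms by (simp add: nrm_scale abs_mult)
    also have "\<dots> \<le> \<bar>c\<bar> * nrm u * (nrm v * nrm p)"
      using assms that by (intro mult_left_mono Cauchy_Schwarz) (auto simp: nrm_nonneg)
    finally show ?thesis by (simp add: mult_ac)
  qed
  from bounded_operatorsI[OF _ _ _ this] show ?thesis
    using assms by (simp add: ip_simps algebra_simps)
qed

text \<open>Membership depends only on values on \<open>Q\<close>. This is needed because the
  recursion prescribes the iterates on \<open>Q\<close> alone.\<close>

lemma bounded_operators_cong:
  assumes "A \<in> bounded_operators Q ip" "\<And>p. p \<in> Q \<Longrightarrow> B p = A p"
  shows "B \<in> bounded_operators Q ip"
proof -
  obtain C where "\<forall>p\<in>Q. nrm (A p) \<le> C * nrm p"
    using bounded_operatorsD(4)[OF assms(1)] by blast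
  then show ?thesis
    using assms(2) bounded_operatorsD(1-3)[OF assms(1)] by (intro bounded_operatorsI[of _ C]) simp_all
qed

section \<open>Properties inherited by the updated operator\<close>

lemma inverse_bfgs_update_bounded:
  assumes "B \<in> bounded_operators Q ip" "d \<in> Q" "y \<in> Q"
  shows "inverse_bfgs_update ip B d y \<in> bounded_operators Q ip"
proof -
  have w: "d - B y \<in> Q"
    using assms bounded_operatorsD(1) by blast
  \<comment> \<open>The update is \<open>B\<close> plus three rank one operators, with ranges
    spanned by \<open>d - B y\<close>, \<open>d\<close> and \<open>d\<close>.\<close>
  have "(\<lambda>p. B p + (1 / ip d y * ip d p) *\<^sub>R (d - B y) + (1 / ip d y * ip (d - B y) p) *\<^sub>R d
      + (- (ip (d - B y) y / (ip d y)\<^sup>2) * ip d p) *\<^sub>R d) \<in> bounded_operators Q ip"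
    by (intro bounded_operators_add rank_one_bounded assms w)
  then show ?thesis
    by (rule bounded_operators_cong) (simp add: inverse_bfgs_update_def scaleR_add_right)
qed

text \<open>The first correction is a rank one operator plus its adjoint, and the second is a
  multiple of the symmetric operator sending \<open>p\<close> to
  \<open>ip d p *\<^sub>R d\<close>.\<close>

lemma inverse_bfgs_update_symmetric:
  assumes B: "B \<in> bounded_operators Q ip" "symmetric_operator Q ip B" and "d \<in> Q" "y \<in> Q"
  shows "symmetric_operator Q ip (inverse_bfgs_update ip B d y)"
  unfolding symmetric_operator_def
proof (intro ballI)
  fix p r
  assume pr: "p \<in> Q" "r \<in> Q"
  have w: "d - B y \<in> Q"
    using assms bounded_operatorsD(1) by blast
  have "ip (B p) r = ip p (B r)"
    using B(2) pr by (simp add: symmetric_operator_def)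
  moreover have "B p \<in> Q" "B r \<in> Q"
    using B(1) pr bounded_operatorsD(1) by blast+
  \<comment> \<open>Naming the difference keeps it atomic, so that the linearity rules do not split
    it.\<close>
  moreover define v where "v = d - B y"
  ultimately show "ip (inverse_bfgs_update ip B d y p) r = ip p (inverse_bfgs_update ip B d y r)"
    using pr w assms(3) unfolding inverse_bfgs_update_def v_def[symmetric]
    by (simp add: add_left add_right scale_left scale_right diff_left diff_right
        sym[of p d] sym[of p v] algebra_simps)
qed

text \<open>This is the product form of inverse BFGS, (I - \<rho> d y^T) B (I - \<rho> y d^T) +
  \<rho> d d^T with \<rho> = 1 / (d, y), tested with \<open>p\<close>: the right factor maps
  \<open>p\<close> to \<open>p - a *\<^sub>R y\<close>.\<close>

lemma inverse_bfgs_update_quadratic_form: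
  assumes B: "B \<in> bounded_operators Q ip" "symmetric_operator Q ip B"
    and Q: "d \<in> Q" "y \<in> Q" "p \<in> Q" and dy: "ip d y \<noteq> 0"
  defines "a \<equiv> ip d p / ip d y"
  shows "ip p (inverse_bfgs_update ip B d y p) =
    ip (p - a *\<^sub>R y) (B (p - a *\<^sub>R y)) + (ip d p)\<^sup>2 / ip d y"
proof -
  have BQ: "B p \<in> Q" "B y \<in> Q"
    using B(1) Q bounded_operatorsD(1) by blast+
  have s: "ip (B y) p = ip p (B y)" "ip (B y) y = ip y (B y)" "ip p d = ip d p"
    using sym BQ Q by auto
  have s': "ip y (B p) = ip p (B y)"
    using B(2) Q s(1) by (auto simp: symmetric_operator_def)
  have B_diff: "B (p - a *\<^sub>R y) = B p - a *\<^sub>R B y"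
    using Q bounded_operatorsD(3,5)[OF B(1)] by simp
  have "ip p (inverse_bfgs_update ip B d y p) =
      ip p (B p) + 1 / ip d y * (2 * ip d p * (ip d p - ip p (B y)))
      - (ip d y - ip y (B y)) / (ip d y)\<^sup>2 * (ip d p)\<^sup>2"
    using Q BQ s by (simp add: inverse_bfgs_update_def ip_simps power2_eq_square algebra_simps)
  \<comment> \<open>The first correction contributes (d, p)^2 / (d, y) twice and the second removes
    it once.\<close>
  also have "\<dots> = ip p (B p) - 2 * a * ip p (B y) + a\<^sup>2 * ip y (B y) + (ip d p)\<^sup>2 / ip d y"
    using dy by (simp add: a_def field_simps power2_eq_square)
  \<comment> \<open>Symmetry of \<open>B\<close>, through \<open>s'\<close>, merges the two cross
    terms of the expanded square.\<close>
  also have "\<dots> = ip (p - a *\<^sub>R y) (B (p - a *\<^sub>R y)) + (ip d p)\<^sup>2 / ip d y"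
    using Q BQ s' by (simp add: B_diff ip_simps power2_eq_square algebra_simps)
  finally show ?thesis .
qed

lemma inverse_bfgs_update_positive_definite:
  assumes B: "B \<in> bounded_operators Q ip" "symmetric_operator Q ip B" "positive_definite Q ip B"
    and Q: "d \<in> Q" "y \<in> Q" and dy: "0 < ip d y"
  shows "positive_definite Q ip (inverse_bfgs_update ip B d y)"
  unfolding positive_definite_def
proof
  fix p
  assume p: "p \<in> Q - {0}"
  define a where "a = ip d p / ip d y"
  have eq: "ip p (inverse_bfgs_update ip B d y p) =
      ip (p - a *\<^sub>R y) (B (p - a *\<^sub>R y)) + (ip d p)\<^sup>2 / ip d y"
    using inverse_bfgs_update_quadratic_form[OF B(1,2) Q] p dy by (simp add: a_def)
  show "0 < ip p (inverse_bfgs_update ip B d y p)"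
  proof (cases "p = a *\<^sub>R y")
    case True
    \<comment> \<open>Otherwise \<open>a = 0\<close>, and \<open>p = a *\<^sub>R y\<close> would be
      zero.\<close>
    then have "ip d p \<noteq> 0"
      using p by (auto simp: a_def)
    then have "0 < (ip d p)\<^sup>2 / ip d y"
      using dy by simp
    moreover have "B 0 = 0"
      using bounded_operatorsD(3)[OF B(1), of 0 0] by simp
    then have "ip (p - a *\<^sub>R y) (B (p - a *\<^sub>R y)) = 0"
      using True by simp
    ultimately show ?thesis
      using eq by simp
  next
    case False
    then have "0 < ip (p - a *\<^sub>R y) (B (p - a *\<^sub>R y))"
      using B(3) p Q by (simp add: positive_definite_def)
    moreover have "0 \<le> (ip d p)\<^sup>2 / ip d y"
      using dy by simp
    ultimately show ?thesis
      using eq by simp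
  qed
qed

section \<open>Damping and the induction step\<close>

lemma damped_step_mem:
  assumes "B \<in> bounded_operators Q ip" "s \<in> Q" "y \<in> Q"
  shows "damped_step ip \<xi> B s y \<in> Q"
  using assms bounded_operatorsD(1) by (auto simp: damped_step_def Let_def)

text \<open>Positive definiteness yields \<open>0 < ip y (B y)\<close> only for nonzero
  \<open>y\<close>; at \<open>y = 0\<close> the product with the damped step is 0, so strict
  positivity is claimed away from zero.\<close>

lemma damped_step_curvature:
  assumes B: "B \<in> bounded_operators Q ip" "positive_definite Q ip B"
    and Q: "s \<in> Q" "y \<in> Q" "y \<noteq> 0" and \<xi>: "0 < \<xi>" "\<xi> < 1"
  shows "0 < ip y (damped_step ip \<xi> B s y)"
proof -
  define a where "a = ip y (B y)"
  have a: "0 < a"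
    using B(2) Q by (simp add: positive_definite_def a_def)
  then have \<xi>a: "0 < \<xi> * a" "\<xi> * a < a"
    using \<xi> by simp_all
  have ByQ: "B y \<in> Q"
    using B(1) Q bounded_operatorsD(1) by blast
  show ?thesis
  proof (cases "\<xi> * a \<le> ip y s")
    case True
    then show ?thesis
      using \<xi>a(1) by (simp add: damped_step_def damping_parameter_def a_def)
  next
    case False
    define \<theta> where "\<theta> = (1 - \<xi>) * (a / (a - ip y s))"
    have "damped_step ip \<xi> B s y = \<theta> *\<^sub>R s + (1 - \<theta>) *\<^sub>R B y"
      using False sym[OF Q(1,2)]
      by (simp add: damped_step_def damping_parameter_def Let_def a_def \<theta>_def)
    then have "ip y (damped_step ip \<xi> B s y) = \<theta> * ip y s + (1 - \<theta>) * a"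
      using Q ByQ by (simp add: add_right scale_right a_def)
    also have "\<dots> = a - \<theta> * (a - ip y s)"
      by (simp add: algebra_simps)
    \<comment> \<open>Here \<open>ip y s < \<xi> * a\<close> and \<open>\<xi> * a < a\<close>, so
      the denominator of \<theta> is positive and cancels.\<close>
    also have "\<theta> * (a - ip y s) = (1 - \<xi>) * a"
      using False \<xi>a by (simp add: \<theta>_def)
    finally show ?thesis
      using \<xi>a by (simp add: algebra_simps)
  qed
qed

lemma damped_update_preserves:
  assumes B: "B \<in> bounded_operators Q ip" "symmetric_operator Q ip B" "positive_definite Q ip B"
    and Q: "s \<in> Q" "y \<in> Q" and \<xi>: "0 < \<xi>" "\<xi> < 1"
    and B': "\<And>p. p \<in> Q \<Longrightarrow> B' p = inverse_bfgs_update ip B (damped_step ip \<xi> B s y) y p"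
  shows "B' \<in> bounded_operators Q ip \<and> symmetric_operator Q ip B' \<and> positive_definite Q ip B'"
proof -
  let ?d = "damped_step ip \<xi> B s y"
  have d: "?d \<in> Q"
    using damped_step_mem B(1) Q .
  have "positive_definite Q ip (inverse_bfgs_update ip B ?d y)"
  proof (cases "y = 0")
    \<comment> \<open>With \<open>y = 0\<close> all divisors are zero, so both corrections vanish by
      the convention \<open>x / 0 = 0\<close> and the update equals \<open>B\<close>.\<close>
    case True
    then show ?thesis
      using B(3) d by (simp add: positive_definite_def inverse_bfgs_update_def)
  next
    case False
    then have "0 < ip ?d y"
      using damped_step_curvature[OF B(1,3) Q False \<xi>] sym[OF d Q(2)] by simp
    then show ?thesis
      by (rule inverse_bfgs_update_positive_definite[OF B d Q(2)])
  qed
  then show ?thesis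
    using bounded_operators_cong[OF inverse_bfgs_update_bounded[OF B(1) d Q(2)] B']
      inverse_bfgs_update_symmetric[OF B(1,2) d Q(2)] B'
    by (simp add: symmetric_operator_def positive_definite_def)
qed

end

theorem lemma1:
  fixes \<Omega> :: "(real^'d::finite) set"
    and ip :: "'d vfield \<Rightarrow> 'd vfield \<Rightarrow> real"
    and s y dt :: "nat \<Rightarrow> 'd vfield"
    and B :: "nat \<Rightarrow> 'd vfield \<Rightarrow> 'd vfield"
    and \<xi> :: real
  assumes "CARD('d) \<in> {2, 3}"
    and "open \<Omega>" and "\<Omega> \<noteq> {}" and "simply_connected \<Omega>"
    and "H1_inner_product \<Omega> ip"
    and "\<forall>k. s k \<in> H1 \<Omega>" and "\<forall>k. y k \<in> H1 \<Omega>"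
    and "B 0 \<in> bounded_operators (H1 \<Omega>) ip"
    and "symmetric_operator (H1 \<Omega>) ip (B 0)"
    and "positive_definite (H1 \<Omega>) ip (B 0)"
    and "0 < \<xi>" and "\<xi> < 1"
    and "\<forall>k. dt k = damped_step ip \<xi> (B k) (s k) (y k)"
    and "\<forall>k. \<forall>p\<in>H1 \<Omega>. B (Suc k) p = inverse_bfgs_update ip (B k) (dt k) (y k) p"
  shows "(\<forall>k. y k \<noteq> 0 \<longrightarrow> 0 < ip (y k) (dt k)) \<and>
         (\<forall>k. B k \<in> bounded_operators (H1 \<Omega>) ip \<and> positive_definite (H1 \<Omega>) ip (B k))"
proof -
  have "\<Omega> \<in> sets lebesgue"
    using \<open>open \<Omega>\<close> by simp
  then interpret inner_product_subspace "H1 \<Omega>" ip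
    using \<open>H1_inner_product \<Omega> ip\<close>
    by unfold_locales (auto simp: subspace_H1 H1_inner_product_def)
  \<comment> \<open>Symmetry joins the induction hypothesis because completing the square in the
    next update relies on it.\<close>
  have inv: "B k \<in> bounded_operators (H1 \<Omega>) ip \<and> symmetric_operator (H1 \<Omega>) ip (B k) \<and>
      positive_definite (H1 \<Omega>) ip (B k)" for k
  proof (induction k)
    case 0
    show ?case using assms(8-10) by simp
  next
    case (Suc k)
    then show ?case
      using damped_update_preserves[of "B k" "s k" "y k" \<xi> "B (Suc k)"] assms(6,7,11-14) by simp
  qed
  then show ?thesis
    using damped_step_curvature assms(6,7,11-13) by simp
qed

end
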